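(* Let $\boldsymbol Y\sim H=\mathrm{GP}(G)$ be a $d$-variate multivariate generalized Pareto (mgp) random vector, where $G$ is a multivariate extreme-value distribution with standard Gumbel margins, and let $\boldsymbol U$ be a $\boldsymbol U$-generator of $H$. If $\boldsymbol U$ has density $f_{\boldsymbol U}$ with respect to the measure $\upsilon$ defined in the context, then $\boldsymbol Y$ has density $h_{\boldsymbol Y}$ with respect to $\upsilon$ equal to $$h_{\boldsymbol Y}(\boldsymbol y)=\mathbb 1\{\max(\boldsymbol y)>0\}\,\frac{1}{\mathsf E[e^{\max(\boldsymbol U)}]}\int_{r\in\mathbb R} f_{\boldsymbol U}(r+\boldsymbol y)\,e^{r}\,\mathrm dr .$$
   Context: $D=\{1,\dots,d\}$; vector operations are componentwise; $e^{-\infty}=0$ and $r+(-\infty)=-\infty$; $\boldsymbol x\not\le\boldsymbol 1$ means $x_j>1$ for some $j$. $G$ is a multivariate extreme-value distribution with Gumbel margins $G_j(x)=\exp(-e^{-x})$, and $G^*(\boldsymbol x)=G(\ln x_1,\dots,\ln x_d)$ is its version with unit-Fréchet margins. Its exponent measure $\mu$ is the Borel measure on $\mathbb E=[0,\infty)^d\setminus\{\boldsymbol 0\}$ with $G^*(\boldsymbol x)=\exp\{-\mu(\mathbb E\setminus[\boldsymbol 0,\boldsymbol x])\}$, and its stable tail dependence function is $\ell(\boldsymbol x)=-\ln G^*(1/\boldsymbol x)$, $\boldsymbol x\in[0,\infty)^d$. The mgp distribution $\mathrm{GP}(G)$ is the law of the random vector $\boldsymbol Y$ in $[-\infty,\infty)^d$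 with $$\mathsf P[e^{\boldsymbol Y}\in B]=\frac{\mu(B\cap\{\boldsymbol x\ge\boldsymbol 0:\boldsymbol x\not\le\boldsymbol 1\})}{\mu(\{\boldsymbol x\ge\boldsymbol 0:\boldsymbol x\not\le\boldsymbol 1\})},\quad B\subseteq[\boldsymbol 0,\boldsymbol\infty)\text{ Borel}.$$ A $\boldsymbol U$-generator of $H$ is a random vector $\boldsymbol U$ in $[-\infty,\infty)^d$ with $\mathsf E[e^{U_j}]=1$ for all $j\in D$ (normalization assumed without loss of generality) and $\ell(\boldsymbol y)=\mathsf E[\max(\boldsymbol y e^{\boldsymbol U})]$ for all $\boldsymbol y\in[0,\infty)^d$. Equivalently, $\boldsymbol Y\overset{d}{=}E+\boldsymbol S$ with $E$ unit exponential independent of $\boldsymbol S$, where $\mathsf P[\boldsymbol S\in B]=\mathsf E[\mathbb 1\{\boldsymbol U-\max(\boldsymbol U)\in B\}e^{\max(\boldsymbol U)}]/\mathsf E[e^{\max(\boldsymbol U)}]$. For non-empty $J\subseteq D$, $\mathbb A_J=\{\boldsymbol x\in[-\infty,\infty)^d: x_j>-\infty\text{ iff }j\in J\}$, $\pi_J:\mathbb A_J\to\mathbb R^J$ is $\boldsymbol x\mapsto(x_j)_{j\in J}$, $\lambda_m$ is $m$-dimensional Lebesgue measure, and $\upsilon$ is the measure on $[-\infty,\infty)^d$ given by $\upsilon(\cdot)=\sum_{\emptyset\ne J\subseteq D}\lambda_{|J|}(\pi_J(\cdot\cap\mathbb A_J))$. *)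

theory Defs
  imports "HOL-Probability.Probability"
begin

text \<open>
  Vectors are functions on a finite index type \<open>'d\<close> (the set \<open>D\<close>); Borel structures are those of the
  product topology. Distributions on \<open>\<real>\<^sup>d\<close> are given by their laws.
\<close>

section \<open>Conventions on extended reals\<close>

text \<open>\<open>exp\<close> on \<open>[-\<infinity>,\<infinity>)\<close>, with \<open>exp (-\<infinity>) = 0\<close>; it is never applied to \<open>\<infinity>\<close>.\<close>

definition ext_exp :: "ereal \<Rightarrow> real" where
  "ext_exp x = (if x = -\<infinity> then 0 else exp (real_of_ereal x))"

text \<open>\<open>ln\<close> on \<open>[0,\<infinity>]\<close>, with \<open>ln 0 = -\<infinity>\<close> and \<open>ln \<infinity> = \<infinity>\<close>.\<close>

definition ext_ln :: "ereal \<Rightarrow> ereal" where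
  "ext_ln x = (if x \<le> 0 then -\<infinity> else if x = \<infinity> then \<infinity> else ereal (ln (real_of_ereal x)))"

text \<open>The space \<open>[-\<infinity>,\<infinity>)\<^sup>d\<close> with its Borel sets; only the \<open>\<sigma>\<close>-algebra is relevant.\<close>

definition ext_borel :: "('d::finite \<Rightarrow> ereal) measure" where
  "ext_borel = restrict_space borel {x. \<forall>j. x j < \<infinity>}"

section \<open>The reference measure\<close>

definition face :: "'d set \<Rightarrow> ('d::finite \<Rightarrow> ereal) set" where
  "face J = {x. (\<forall>j. x j < \<infinity>) \<and> (\<forall>j. x j > -\<infinity> \<longleftrightarrow> j \<in> J)}"

definition face_proj :: "'d set \<Rightarrow> ('d::finite \<Rightarrow> ereal) \<Rightarrow> ('d \<Rightarrow> real)" where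
  "face_proj J x = restrict (\<lambda>j. real_of_ereal (x j)) J"

text \<open>\<open>Pi\<^sub>M J (\<lambda>_. lborel)\<close> is \<open>|J|\<close>-dimensional Lebesgue measure on \<open>\<real>\<^sup>J\<close>.\<close>

definition upsilon :: "('d::finite \<Rightarrow> ereal) measure" where
  "upsilon = measure_of (space ext_borel) (sets ext_borel)
     (\<lambda>A. \<Sum>J\<in>{J. J \<noteq> {}}. emeasure (Pi\<^sub>M J (\<lambda>_. lborel)) (face_proj J ` (A \<inter> face J)))"

section \<open>Multivariate extreme-value distributions\<close>

text \<open>The joint distribution function, extended to \<open>[-\<infinity>,\<infinity>]\<^sup>d\<close>.\<close>

definition mcdf :: "('d::finite \<Rightarrow> real) measure \<Rightarrow> ('d \<Rightarrow> ereal) \<Rightarrow> real" where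
  "mcdf G x = measure G {z. \<forall>j. ereal (z j) \<le> x j}"

text \<open>
  A law with non-degenerate margins that arises as the weak limit of affinely normalized
  componentwise maxima of i.i.d. random vectors with law \<open>F\<close>.
\<close>

definition multivariate_extreme_value :: "('d::finite \<Rightarrow> real) measure \<Rightarrow> bool" where
  "multivariate_extreme_value G \<longleftrightarrow>
     prob_space G \<and> sets G = sets borel \<and>
     (\<forall>j c. measure G {z. z j = c} \<noteq> 1) \<and>
     (\<exists>F a b. prob_space F \<and> sets F = sets (borel :: ('d \<Rightarrow> real) measure) \<and>
        (\<forall>n j. a n j > (0::real)) \<and>
        (\<forall>x. ((\<lambda>y. mcdf G (\<lambda>j. ereal (y j))) \<longlongrightarrow> mcdf G (\<lambda>j. ereal (x j))) (at x) \<longrightarrow>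
          (\<lambda>n. mcdf F (\<lambda>j. ereal (a n j * x j + b n j)) ^ n) \<longlonglongrightarrow> mcdf G (\<lambda>j. ereal (x j))))"

definition gumbel_margins :: "('d::finite \<Rightarrow> real) measure \<Rightarrow> bool" where
  "gumbel_margins G \<longleftrightarrow> (\<forall>j x. cdf (distr G borel (\<lambda>z. z j)) x = exp (- exp (- x)))"

definition frechet_version :: "('d::finite \<Rightarrow> real) measure \<Rightarrow> ('d \<Rightarrow> ereal) \<Rightarrow> real" where
  "frechet_version G x = mcdf G (\<lambda>j. ext_ln (x j))"

definition punctured_orthant :: "('d::finite \<Rightarrow> real) set" where
  "punctured_orthant = {z. (\<forall>j. 0 \<le> z j) \<and> (\<exists>j. z j \<noteq> 0)}"

text \<open>
  For \<open>x\<close> with a zero coordinate both sides of the identity are \<open>0\<close>, through \<open>exp (-\<infinity>) = 0\<close>.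
\<close>

definition exponent_measure ::
    "('d::finite \<Rightarrow> real) measure \<Rightarrow> ('d \<Rightarrow> real) measure \<Rightarrow> bool" where
  "exponent_measure G \<mu> \<longleftrightarrow>
     sets \<mu> = sets (restrict_space borel punctured_orthant) \<and>
     (\<forall>x. (\<forall>j. 0 \<le> x j) \<longrightarrow>
        frechet_version G (\<lambda>j. ereal (x j)) =
        ext_exp (- enn2ereal (emeasure \<mu>
          (punctured_orthant - {z. \<forall>j. 0 \<le> z j \<and> z j \<le> x j}))))"

text \<open>
  The stable tail dependence function on \<open>[0,\<infinity>)\<^sup>d\<close>. Note that \<open>1 / 0 = \<infinity>\<close> in \<^typ>\<open>ereal\<close>, and that
  the argument of \<open>ln\<close> is positive for extreme-value \<open>G\<close> with Gumbel margins.
\<close>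

definition stdf :: "('d::finite \<Rightarrow> real) measure \<Rightarrow> ('d \<Rightarrow> real) \<Rightarrow> real" where
  "stdf G x = - ln (frechet_version G (\<lambda>j. 1 / ereal (x j)))"

section \<open>Multivariate generalized Pareto distributions\<close>

definition exceedance_set :: "('d::finite \<Rightarrow> real) set" where
  "exceedance_set = {x. (\<forall>j. 0 \<le> x j) \<and> (\<exists>j. x j > 1)}"

text \<open>
  \<open>mgp_law G H\<close> says \<open>H = GP(G)\<close>; the exponent measure \<open>\<mu>\<close> is determined by \<open>G\<close>, and \<open>H\<close> by the
  induced law of the componentwise exponential.
\<close>

definition mgp_law ::
    "('d::finite \<Rightarrow> real) measure \<Rightarrow> ('d \<Rightarrow> ereal) measure \<Rightarrow> bool" where
  "mgp_law G H \<longleftrightarrow>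
     prob_space H \<and> sets H = sets ext_borel \<and>
     (\<exists>\<mu>. exponent_measure G \<mu> \<and>
        (\<forall>B\<in>sets borel. B \<subseteq> {x. \<forall>j. 0 \<le> x j} \<longrightarrow>
           emeasure H {y\<in>space H. (\<lambda>j. ext_exp (y j)) \<in> B} =
           emeasure \<mu> (B \<inter> exceedance_set) / emeasure \<mu> exceedance_set))"

text \<open>
  \<open>U\<close>, defined on the probability space \<open>N\<close>, is a \<open>U\<close>-generator of \<open>GP(G)\<close>. The first integral
  condition includes integrability, since the Bochner integral of a non-integrable function is \<open>0\<close>.
\<close>

definition U_generator ::
    "'b measure \<Rightarrow> ('b \<Rightarrow> 'd::finite \<Rightarrow> ereal) \<Rightarrow> ('d \<Rightarrow> real) measure \<Rightarrow> bool" where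
  "U_generator N U G \<longleftrightarrow>
     prob_space N \<and> U \<in> measurable N ext_borel \<and>
     (\<forall>j. (\<integral>\<omega>. ext_exp (U \<omega> j) \<partial>N) = 1) \<and>
     (\<forall>y. (\<forall>j. 0 \<le> y j) \<longrightarrow>
        stdf G y = (\<integral>\<omega>. Max (range (\<lambda>j. y j * ext_exp (U \<omega> j))) \<partial>N))"

end

theory Submission
  imports Defs
begin

text \<open>
  The sets \<open>{y. \<forall>j. y j \<le> x j}\<close> with \<open>x\<close> real form a generating \<open>\<pi>\<close>-system of \<open>[-\<infinity>,\<infinity>)\<^sup>d\<close>, and both laws
  give such a set the mass \<open>E[(exp (max U) - exp (max (U - x)))\<^sup>+] / E[exp (max U)]\<close>. For \<open>GP(G)\<close>, the
  generator property says that the complement of the box \<open>[0, exp x]\<close> has exponent measure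
  \<open>E[exp (max (U - x))]\<close>, and the exceedances inside the box are a difference of two such complements.
  For the claimed density, diagonal translations preserve the reference measure on every face, so
  by Tonelli the mass is the expectation of the integral of \<open>exp r\<close> over all \<open>r\<close> with
  \<open>max (U - x) \<le> r < max U\<close>.
\<close>

section \<open>The extended Borel space\<close>

lemma space_ext_borel: "space ext_borel = {x. \<forall>j. x j < \<infinity>}"
  by (simp add: ext_borel_def space_restrict_space)

text \<open>On a finite index type the Borel \<sigma>-algebra of the product topology is the product
  \<sigma>-algebra, so coordinatewise measurability is enough; the finiteness bound places the
  values in the restricted space.\<close>

lemma measurable_to_ext_borel:
  fixes f :: "'a \<Rightarrow> 'd::finite \<Rightarrow> ereal"
  assumes "\<And>j. (\<lambda>x. f x j) \<in> borel_measurable M"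
    and "\<And>x j. x \<in> space M \<Longrightarrow> f x j < \<infinity>"
  shows "f \<in> measurable M ext_borel"
proof -
  have "(\<lambda>x. \<lambda>j\<in>UNIV. f x j) \<in> measurable M (Pi\<^sub>M UNIV (\<lambda>_. borel))"
    by (rule measurable_restrict) (rule assms(1))
  then have "f \<in> borel_measurable M"
    by (simp add: measurable_cong_sets[OF refl sets_PiM_equal_borel] restrict_UNIV)
  then show ?thesis
    unfolding ext_borel_def by (rule measurable_restrict_space2[rotated]) (use assms(2) in auto)
qed

lemma measurable_ext_borel_component [measurable]: "(\<lambda>x. x j) \<in> borel_measurable ext_borel"
  unfolding ext_borel_def by (rule measurable_restrict_space1) simp

definition ext_atMost :: "('d::finite \<Rightarrow> real) \<Rightarrow> ('d \<Rightarrow> ereal) set" where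
  "ext_atMost x = {y. \<forall>j. y j \<le> ereal (x j)}"

lemma ext_atMost_subset: "ext_atMost x \<subseteq> space ext_borel"
  proof
  fix y assume "y \<in> ext_atMost x"
  then have "y j < \<infinity>" for j
    by (intro le_less_trans[of "y j" "ereal (x j)"]) (auto simp: ext_atMost_def)
  then show "y \<in> space ext_borel" by (simp add: space_ext_borel)
qed

lemma ext_atMost_sets [measurable]: "ext_atMost x \<in> sets ext_borel"
proof -
  have "ext_atMost x = {y \<in> space ext_borel. \<forall>j. y j \<le> ereal (x j)}"
    using ext_atMost_subset[of x] by (auto simp: ext_atMost_def)
  then show ?thesis by simp
qed

text \<open>Finitely many coordinates, each below \<infinity>, have a common natural bound. Hence
  countably many orthants exhaust the space, which both the generation of the \<sigma>-algebra and
  the uniqueness argument use.\<close>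

lemma ext_borel_bounded:
  assumes "y \<in> space ext_borel"
  shows "\<exists>n::nat. y \<in> ext_atMost (\<lambda>_. real n)"
proof -
  have "\<exists>n::nat. y j \<le> ereal (real n)" for j
    using assms by (cases "y j") (auto simp: space_ext_borel real_arch_simple dest: spec[of _ j])
  then obtain n :: "'a \<Rightarrow> nat" where n: "\<And>j. y j \<le> ereal (real (n j))" by metis
  have "y j \<le> ereal (real (Max (range n)))" for j
    by (rule order_trans[OF n]) simp
  then show ?thesis by (auto simp: ext_atMost_def)
qed

text \<open>For the nontrivial inclusion, each coordinate is shown measurable for the
  \<sigma>-algebra generated by the orthants; then the identity map into \<open>ext_borel\<close> is
  measurable, and its preimages are the Borel sets themselves.\<close>

lemma sets_ext_borel_generator:
  "sets (ext_borel :: ('d::finite \<Rightarrow> ereal) measure) = sigma_sets (space ext_borel) (range ext_atMost)"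
proof (rule antisym)
  let ?\<Omega> = "space (ext_borel :: ('d \<Rightarrow> ereal) measure)"
  let ?S = "sigma ?\<Omega> (range ext_atMost)"
  have sub: "range ext_atMost \<subseteq> Pow ?\<Omega>" using ext_atMost_subset by auto
  then have sp: "space ?S = ?\<Omega>" and st: "sets ?S = sigma_sets ?\<Omega> (range ext_atMost)"
    by (simp_all add: space_measure_of sets_measure_of)
  have gen: "ext_atMost x \<in> sets ?S" for x
    unfolding st by (rule sigma_sets.Basic) simp
  have fin: "{y \<in> ?\<Omega>. y j \<le> ereal a} \<in> sets ?S" for a j
  proof -
    \<comment> \<open>A half-space is a countable union of orthants: the corner stays at
      \<open>a\<close> in coordinate \<open>j\<close> and grows to \<infinity> in the
      others.\<close>
    have "{y \<in> ?\<Omega>. y j \<le> ereal a} = (\<Union>n. ext_atMost ((\<lambda>_. real n)(j := a)))"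
    proof (rule set_eqI, rule iffI)
      fix y assume y: "y \<in> {y \<in> ?\<Omega>. y j \<le> ereal a}"
      then obtain n :: nat where "y \<in> ext_atMost (\<lambda>_. real n)" using ext_borel_bounded by blast
      with y show "y \<in> (\<Union>n. ext_atMost ((\<lambda>_. real n)(j := a)))"
        by (auto simp: ext_atMost_def)
    next
      fix y assume "y \<in> (\<Union>n. ext_atMost ((\<lambda>_. real n)(j := a)))"
      then obtain n where n: "y \<in> ext_atMost ((\<lambda>_. real n)(j := a))" by blast
      then have "y \<in> ?\<Omega>" using ext_atMost_subset by blast
      with n show "y \<in> {y \<in> ?\<Omega>. y j \<le> ereal a}"
        by (auto simp: ext_atMost_def dest: spec[of _ j])
    qed
    then show ?thesis using gen by auto
  qed
  have "(\<lambda>y. y j) \<in> borel_measurable ?S" for j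
  proof (rule borel_measurableI_le, unfold sp)
    fix a :: ereal
    show "{y \<in> ?\<Omega>. y j \<le> a} \<in> sets ?S"
    proof (cases a)
      case (real r) then show ?thesis using fin by simp
    next
      case PInf then show ?thesis using sets.top[of ?S] by (simp add: sp)
    next
      case MInf
      \<comment> \<open>The level -\<infinity> is not the coordinate of a real corner; it is reached
        as the intersection of the levels -n.\<close>
      have "x = -\<infinity>" if "\<And>n::nat. x \<le> ereal (- real n)" for x
      proof (cases x)
        case (real t)
        obtain n :: nat where "- t < real n" using reals_Archimedean2 by blast
        with that[of n] real show ?thesis by simp
      qed (use that[of 0] in auto)
      then have "{y \<in> ?\<Omega>. y j \<le> a} = (\<Inter>n::nat. {y \<in> ?\<Omega>. y j \<le> ereal (- real n)})"
        using MInf by auto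
      then show ?thesis using fin by (auto intro!: sets.countable_INT)
    qed
  qed
  then have "(\<lambda>y. y) \<in> measurable ?S ext_borel"
  proof (rule measurable_to_ext_borel)
    fix y j assume "y \<in> space ?S"
    then have "y \<in> ?\<Omega>" by (simp only: sp)
    then show "y j < \<infinity>" by (simp add: space_ext_borel)
  qed
  note id = measurable_sets[OF this]
  show "sets ext_borel \<subseteq> sigma_sets ?\<Omega> (range ext_atMost)"
  proof (intro subsetI)
    fix A assume A: "A \<in> sets (ext_borel :: ('d \<Rightarrow> ereal) measure)"
    have "(\<lambda>y. y) -` A \<inter> space ?S = A" using sets.sets_into_space[OF A] sp by auto
    then show "A \<in> sigma_sets ?\<Omega> (range ext_atMost)"
      using id[OF A] st by simp
  qed
qed (intro sets.sigma_sets_subset subsetI, auto)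

text \<open>Uniqueness on a generating \<pi>-system: two orthants meet in the orthant at the
  componentwise minimum of their corners, and the orthants at constant corners n cover the space
  with finite \<open>P\<close>-mass. Agreement on orthants then also makes the cover finite for
  \<open>Q\<close>.\<close>

lemma ext_borel_measure_eqI:
  fixes P Q :: "('d::finite \<Rightarrow> ereal) measure"
  assumes "finite_measure P" and P: "sets P = sets ext_borel" and Q: "sets Q = sets ext_borel"
    and eq: "\<And>x. emeasure P (ext_atMost x) = emeasure Q (ext_atMost x)"
  shows "P = Q"
proof (rule measure_eqI_generator_eq)
  show "Int_stable (range ext_atMost :: ('d \<Rightarrow> ereal) set set)"
  proof (rule Int_stableI_image)
    fix x x' :: "'d \<Rightarrow> real"
    have "a \<le> ereal (min b c) \<longleftrightarrow> a \<le> ereal b \<and> a \<le> ereal c" for a b c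
      by (cases a) auto
    then have "ext_atMost x \<inter> ext_atMost x' = ext_atMost (\<lambda>j. min (x j) (x' j))"
      by (auto simp: ext_atMost_def)
    then show "\<exists>z\<in>UNIV. ext_atMost x \<inter> ext_atMost x' = ext_atMost z" by blast
  qed
  show "range (ext_atMost :: _ \<Rightarrow> ('d \<Rightarrow> ereal) set) \<subseteq> Pow (space ext_borel)"
    using ext_atMost_subset by auto
  show "(\<Union>n::nat. ext_atMost (\<lambda>_. real n)) = space (ext_borel :: ('d \<Rightarrow> ereal) measure)"
  proof (intro antisym subsetI UN_least ext_atMost_subset)
    fix y assume "y \<in> space (ext_borel :: ('d \<Rightarrow> ereal) measure)"
    then show "y \<in> (\<Union>n::nat. ext_atMost (\<lambda>_. real n))" by (simp add: ext_borel_bounded)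
  qed (use ext_atMost_subset in blast)
  show "emeasure P (ext_atMost (\<lambda>_. real n)) \<noteq> \<infinity>" for n :: nat
    using \<open>finite_measure P\<close> by (simp add: finite_measure.emeasure_finite)
  show "emeasure P X = emeasure Q X" if "X \<in> range ext_atMost" for X
    using that by (elim imageE) (simp add: eq)
  show "range (\<lambda>n::nat. ext_atMost (\<lambda>_. real n)) \<subseteq> (range ext_atMost :: ('d \<Rightarrow> ereal) set set)"
    by (intro image_subsetI rangeI)
qed (simp_all only: P Q sets_ext_borel_generator)

section \<open>The reference measure\<close>

text \<open>The inverse of \<open>face_proj J\<close> on the face. Through it the reference measure
  becomes a sum of push-forwards of Lebesgue measures.\<close>

definition face_emb :: "'d set \<Rightarrow> ('d::finite \<Rightarrow> real) \<Rightarrow> 'd \<Rightarrow> ereal" where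
  "face_emb J z j = (if j \<in> J then ereal (z j) else -\<infinity>)"

lemma face_emb_measurable [measurable]:
  "face_emb J \<in> measurable (Pi\<^sub>M J (\<lambda>_. lborel)) ext_borel"
proof (rule measurable_to_ext_borel)
  show "(\<lambda>x. face_emb J x j) \<in> borel_measurable (Pi\<^sub>M J (\<lambda>_. lborel))" for j
    by (cases "j \<in> J") (simp_all add: face_emb_def)
qed (simp add: face_emb_def)

text \<open>\<open>face_proj J\<close> is a bijection from the face onto the extensional functions
  on \<open>J\<close>, with inverse \<open>face_emb J\<close>. An image, whose measurability is
  unclear, thus becomes a preimage under a measurable map.\<close>

lemma face_proj_image_eq_vimage:
  assumes "A \<subseteq> space ext_borel"
  shows "face_proj J ` (A \<inter> face J) = face_emb J -` A \<inter> space (Pi\<^sub>M J (\<lambda>_. lborel))"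
proof -
  have 1: "face_emb J (face_proj J x) = x" if "x \<in> face J" for x
  proof
    fix j show "face_emb J (face_proj J x) j = x j"
      using that by (cases "x j"; cases "j \<in> J") (auto simp: face_def face_emb_def face_proj_def dest: spec[of _ j])
  qed
  have 2: "face_proj J (face_emb J z) = z" if "z \<in> extensional J" for z
    using that by (auto simp: face_proj_def face_emb_def extensional_def)
  have 3: "face_emb J z \<in> face J" for z
    by (auto simp: face_def face_emb_def)
  show ?thesis
  proof (rule set_eqI, rule iffI)
    fix z assume "z \<in> face_proj J ` (A \<inter> face J)"
    then show "z \<in> face_emb J -` A \<inter> space (Pi\<^sub>M J (\<lambda>_. lborel))"
      using 1 by (auto simp: space_PiM PiE_def) (auto simp: face_proj_def)
  next
    fix z assume "z \<in> face_emb J -` A \<inter> space (Pi\<^sub>M J (\<lambda>_. lborel))"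
    then show "z \<in> face_proj J ` (A \<inter> face J)"
      using 2[of z] 3[of z] by (intro image_eqI[of _ _ "face_emb J z"]) (auto simp: space_PiM PiE_def)
  qed
qed

lemma space_upsilon [simp]: "space upsilon = space ext_borel"
  and sets_upsilon [simp, measurable_cong]: "sets upsilon = sets ext_borel"
  by (simp_all add: upsilon_def sets.sets_measure_of_eq sets.space_measure_of_eq)

text \<open>A set function passed to \<open>measure_of\<close> yields its own values only once
  countable additivity is known. Here it coincides with a finite sum of push-forward measures, so
  additivity is inherited by exchanging that sum with the series.\<close>

lemma emeasure_upsilon:
  fixes A :: "('d::finite \<Rightarrow> ereal) set"
  assumes A: "A \<in> sets ext_borel"
  shows "emeasure upsilon A = (\<Sum>J\<in>{J. J \<noteq> {}}. emeasure (distr (Pi\<^sub>M J (\<lambda>_. lborel)) ext_borel (face_emb J)) A)"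
    (is "_ = ?\<mu> A")
proof -
  have eq: "(\<Sum>J\<in>{J. J \<noteq> {}}. emeasure (Pi\<^sub>M J (\<lambda>_. lborel)) (face_proj J ` (B \<inter> face J))) = ?\<mu> B"
    if B: "B \<in> sets ext_borel" for B :: "('d \<Rightarrow> ereal) set"
    by (intro sum.cong refl)
      (simp add: face_proj_image_eq_vimage[OF sets.sets_into_space[OF B]] emeasure_distr[OF _ B])
  show ?thesis
    unfolding eq[OF A, symmetric]
  proof (rule emeasure_measure_of[OF upsilon_def])
    show "sets ext_borel \<subseteq> Pow (space (ext_borel :: ('d \<Rightarrow> ereal) measure))"
      by (rule sets.space_closed)
    let ?\<nu> = "\<lambda>B :: ('d \<Rightarrow> ereal) set. \<Sum>J\<in>{J. J \<noteq> {}}. emeasure (Pi\<^sub>M J (\<lambda>_. lborel)) (face_proj J ` (B \<inter> face J))"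
    show "positive (sets upsilon) ?\<nu>" by (simp add: positive_def)
    show "countably_additive (sets upsilon) ?\<nu>"
    proof (rule countably_additiveI)
      fix B :: "nat \<Rightarrow> ('d \<Rightarrow> ereal) set"
      assume B: "range B \<subseteq> sets upsilon" "disjoint_family B" "(\<Union>i. B i) \<in> sets upsilon"
      then have Bi: "B i \<in> sets ext_borel" for i by auto
      have "(\<Sum>i. ?\<nu> (B i)) = (\<Sum>i. ?\<mu> (B i))" using Bi by (simp only: eq)
      also have "\<dots> = (\<Sum>J\<in>{J. J \<noteq> {}}. \<Sum>i. emeasure (distr (Pi\<^sub>M J (\<lambda>_. lborel)) ext_borel (face_emb J)) (B i))"
        by (rule suminf_sum) simp
      also have "\<dots> = ?\<mu> (\<Union>i. B i)"
        using B Bi by (intro sum.cong refl suminf_emeasure) auto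
      also have "\<dots> = ?\<nu> (\<Union>i. B i)" using B by (intro eq[symmetric]) simp
      finally show "(\<Sum>i. ?\<nu> (B i)) = ?\<nu> (\<Union>i. B i)" .
    qed
    show "A \<in> sets upsilon" using A by simp
  qed
qed

text \<open>Extends the formula from sets to functions by induction on nonnegative measurable
  functions; in the limit step the finite sum commutes with suprema of increasing sequences.\<close>

lemma nn_integral_upsilon:
  fixes g :: "('d::finite \<Rightarrow> ereal) \<Rightarrow> ennreal"
  assumes "g \<in> borel_measurable upsilon"
  shows "(\<integral>\<^sup>+y. g y \<partial>upsilon) = (\<Sum>J\<in>{J. J \<noteq> {}}. \<integral>\<^sup>+z. g (face_emb J z) \<partial>Pi\<^sub>M J (\<lambda>_. lborel))"
proof -
  let ?D = "\<lambda>J. distr (Pi\<^sub>M J (\<lambda>_. lborel)) ext_borel (face_emb J) :: ('d \<Rightarrow> ereal) measure"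
  have "integral\<^sup>N upsilon g = (\<Sum>J\<in>{J. J \<noteq> {}}. integral\<^sup>N (?D J) g)"
    using assms
  proof (induction rule: borel_measurable_induct)
    case (cong f g)
    moreover have "integral\<^sup>N upsilon f = integral\<^sup>N upsilon g"
      "\<And>J. integral\<^sup>N (?D J) f = integral\<^sup>N (?D J) g"
      using cong(3) by (auto intro!: nn_integral_cong)
    ultimately show ?case by simp
  next
    case (set A)
    then show ?case by (simp add: emeasure_upsilon)
  next
    case (mult u c)
    have [measurable]: "u \<in> borel_measurable ext_borel"
      using mult(2) by (simp cong: measurable_cong_sets)
    have "(\<integral>\<^sup>+x. c * u x \<partial>?D J) = c * integral\<^sup>N (?D J) u" for J
      by (rule nn_integral_cmult) simp
    then show ?case using mult by (simp add: nn_integral_cmult sum_distrib_left)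
  next
    case (add u v)
    have [measurable]: "u \<in> borel_measurable ext_borel" "v \<in> borel_measurable ext_borel"
      using add by (simp_all cong: measurable_cong_sets)
    have "(\<integral>\<^sup>+x. v x + u x \<partial>?D J) = integral\<^sup>N (?D J) v + integral\<^sup>N (?D J) u" for J
      by (rule nn_integral_add) simp_all
    then show ?case using add by (simp add: nn_integral_add sum.distrib)
  next
    case (seq U)
    have [measurable]: "U i \<in> borel_measurable ext_borel" for i
      using seq(1) by (simp cong: measurable_cong_sets)
    have mono: "U m x \<le> U n x" if "m \<le> n" for m n x
      using incseqD[OF \<open>incseq U\<close> that] by (rule le_funD)
    have "integral\<^sup>N upsilon (SUP i. U i) = (SUP i. integral\<^sup>N upsilon (U i))"
      unfolding SUP_apply[abs_def] using seq by (intro nn_integral_monotone_convergence_SUP) auto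
    also have "\<dots> = (SUP i. \<Sum>J\<in>{J. J \<noteq> {}}. integral\<^sup>N (?D J) (U i))"
      using seq by simp
    also have "\<dots> = (\<Sum>J\<in>{J. J \<noteq> {}}. SUP i. integral\<^sup>N (?D J) (U i))"
      by (intro ennreal_SUP_sum) (auto simp: incseq_def intro!: nn_integral_mono mono)
    also have "\<dots> = (\<Sum>J\<in>{J. J \<noteq> {}}. integral\<^sup>N (?D J) (SUP i. U i))"
      unfolding SUP_apply[abs_def] using \<open>incseq U\<close>
      by (intro sum.cong refl nn_integral_monotone_convergence_SUP[symmetric]) auto
    finally show ?case .
  qed
  then show ?thesis
    using assms by (simp add: nn_integral_distr cong: measurable_cong_sets)
qed

text \<open>A product measure is determined by its rectangles, and on each side of a rectangle the
  claim is translation invariance in dimension one.\<close>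

lemma distr_PiM_lborel_translate:
  assumes "finite J"
  shows "distr (Pi\<^sub>M J (\<lambda>_. lborel)) (Pi\<^sub>M J (\<lambda>_. lborel)) (\<lambda>z. \<lambda>j\<in>J. r + z j) = Pi\<^sub>M J (\<lambda>_. lborel :: real measure)"
proof -
  interpret product_sigma_finite "\<lambda>_. lborel :: real measure" ..
  show ?thesis
  proof (rule PiM_eqI)
    fix A :: "_ \<Rightarrow> real set" assume A: "\<And>i. i \<in> J \<Longrightarrow> A i \<in> sets lborel"
    have "(\<lambda>z. \<lambda>j\<in>J. r + z j) -` Pi\<^sub>E J A \<inter> space (Pi\<^sub>M J (\<lambda>_. lborel)) = Pi\<^sub>E J (\<lambda>j. (+) r -` A j)"
      by (auto simp: space_PiM PiE_iff)
    moreover have "emeasure lborel ((+) r -` A j) = emeasure lborel (A j)" if "j \<in> J" for j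
      using emeasure_distr[of "(+) r" lborel borel "A j"] A[OF that] by (simp add: lborel_distr_plus)
    moreover have "(+) r -` A j \<in> sets lborel" if "j \<in> J" for j
      using measurable_sets[of "(+) r" lborel borel "A j"] A[OF that] by simp
    ultimately show "emeasure (distr (Pi\<^sub>M J (\<lambda>_. lborel)) (Pi\<^sub>M J (\<lambda>_. lborel)) (\<lambda>z. \<lambda>j\<in>J. r + z j)) (Pi\<^sub>E J A)
        = (\<Prod>i\<in>J. emeasure lborel (A i))"
      using A assms by (subst emeasure_distr) (auto simp: emeasure_PiM sets_PiM_I_finite)
  qed (use assms in auto)
qed

section \<open>Integration along the diagonal direction\<close>

lemma measurable_ext_translate [measurable]:
  "(\<lambda>(r, y) j. ereal r + y j) \<in> measurable (lborel \<Otimes>\<^sub>M ext_borel) (ext_borel :: ('d::finite \<Rightarrow> ereal) measure)"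
proof (rule measurable_to_ext_borel)
  show "(\<lambda>x. (case x of (r, y) \<Rightarrow> \<lambda>j. ereal r + y j) j) \<in> borel_measurable (lborel \<Otimes>\<^sub>M ext_borel)" for j :: 'd
    by (simp add: split_beta)
qed (auto simp: space_pair_measure space_ext_borel)

lemma borel_measurable_translate_integral:
  fixes f :: "('d::finite \<Rightarrow> ereal) \<Rightarrow> ennreal" and w :: "real \<Rightarrow> ennreal"
  assumes [measurable]: "f \<in> borel_measurable ext_borel" "w \<in> borel_measurable borel"
  shows "(\<lambda>y. \<integral>\<^sup>+r. f (\<lambda>j. ereal r + y j) * w r \<partial>lborel) \<in> borel_measurable ext_borel"
proof (rule lborel.borel_measurable_nn_integral)
  have sw: "(\<lambda>(y, r). (r, y)) \<in> measurable (ext_borel \<Otimes>\<^sub>M lborel) (lborel \<Otimes>\<^sub>M ext_borel)"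
    by (simp add: split_beta)
  show "(\<lambda>(y, r). f (\<lambda>j. ereal r + y j) * w r) \<in> borel_measurable (ext_borel \<Otimes>\<^sub>M lborel)"
    using measurable_compose[OF sw measurable_compose[OF measurable_ext_translate assms(1)]]
    by (simp add: split_beta)
qed

text \<open>The change of variables u = r + y for fixed r, framed by two uses of Tonelli. It moves
  the shift from the density \<open>f\<close> to the test function \<open>K\<close>, so that a
  density with an inner integral over r is tested through \<open>f\<close> itself.\<close>

lemma nn_integral_upsilon_translate:
  fixes f K :: "('d::finite \<Rightarrow> ereal) \<Rightarrow> ennreal" and w :: "real \<Rightarrow> ennreal"
  assumes f [measurable]: "f \<in> borel_measurable ext_borel"
    and K [measurable]: "K \<in> borel_measurable ext_borel"
    and w [measurable]: "w \<in> borel_measurable borel"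
  shows "(\<integral>\<^sup>+y. (\<integral>\<^sup>+r. f (\<lambda>j. ereal r + y j) * w r \<partial>lborel) * K y \<partial>upsilon)
       = (\<integral>\<^sup>+u. f u * (\<integral>\<^sup>+r. w r * K (\<lambda>j. ereal (- r) + u j) \<partial>lborel) \<partial>upsilon)"
proof -
  have [measurable]: "(\<lambda>(r, y). f (\<lambda>j. ereal r + y j)) \<in> borel_measurable (lborel \<Otimes>\<^sub>M ext_borel)"
    using measurable_compose[OF measurable_ext_translate f] by (simp add: split_beta)
  have neg: "(\<lambda>(r, y). (- r, y)) \<in> measurable (lborel \<Otimes>\<^sub>M ext_borel) (lborel \<Otimes>\<^sub>M ext_borel)"
    by (simp add: split_beta)
  have [measurable]: "(\<lambda>(r, y). K (\<lambda>j. ereal (- r) + y j)) \<in> borel_measurable (lborel \<Otimes>\<^sub>M ext_borel)"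
    using measurable_compose[OF neg measurable_compose[OF measurable_ext_translate K]]
    by (simp add: split_beta)
  have face: "(\<integral>\<^sup>+z. (\<integral>\<^sup>+r. f (\<lambda>j. ereal r + face_emb J z j) * w r \<partial>lborel) * K (face_emb J z) \<partial>Pi\<^sub>M J (\<lambda>_. lborel))
      = (\<integral>\<^sup>+z. f (face_emb J z) * (\<integral>\<^sup>+r. w r * K (\<lambda>j. ereal (- r) + face_emb J z j) \<partial>lborel) \<partial>Pi\<^sub>M J (\<lambda>_. lborel))"
    (is "?l = ?r") for J :: "'d set"
  proof -
    let ?P = "Pi\<^sub>M J (\<lambda>_. lborel :: real measure)"
    interpret product_sigma_finite "\<lambda>_. lborel :: real measure" ..
    interpret P: finite_product_sigma_finite "\<lambda>_. lborel :: real measure" J by standard simp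
    interpret pair_sigma_finite lborel ?P ..
    \<comment> \<open>Coordinates outside \<open>J\<close> remain -\<infinity> under the shift, so a
      diagonal translation acts within the face as a translation of its Lebesgue space.\<close>
    have tr: "(\<lambda>j. ereal r + face_emb J z j) = face_emb J (\<lambda>j\<in>J. r + z j)" for r z
      by (auto simp: face_emb_def)
    have [measurable]: "(\<lambda>(r, z). f (\<lambda>j. ereal r + face_emb J z j)) \<in> borel_measurable (lborel \<Otimes>\<^sub>M ?P)"
      "(\<lambda>(r, z). K (\<lambda>j. ereal (- r) + face_emb J z j)) \<in> borel_measurable (lborel \<Otimes>\<^sub>M ?P)"
      by simp_all
    have "?l = (\<integral>\<^sup>+z. (\<integral>\<^sup>+r. f (\<lambda>j. ereal r + face_emb J z j) * w r * K (face_emb J z) \<partial>lborel) \<partial>?P)"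
      by (intro nn_integral_cong nn_integral_multc[symmetric]) simp
    also have "\<dots> = (\<integral>\<^sup>+r. (\<integral>\<^sup>+z. f (\<lambda>j. ereal r + face_emb J z j) * w r * K (face_emb J z) \<partial>?P) \<partial>lborel)"
      by (rule Fubini') simp
    also have "\<dots> = (\<integral>\<^sup>+r. (\<integral>\<^sup>+z. f (face_emb J z) * w r * K (\<lambda>j. ereal (- r) + face_emb J z j) \<partial>?P) \<partial>lborel)"
    proof (rule nn_integral_cong)
      fix r :: real
      let ?g = "\<lambda>z. f (face_emb J z) * w r * K (\<lambda>j. ereal (- r) + face_emb J z j)"
      \<comment> \<open>Lebesgue measure is replaced by its translate; after substitution the shift
        inside \<open>K\<close> cancels and the one inside \<open>f\<close> reappears.\<close>
      have "(\<integral>\<^sup>+z. ?g z \<partial>?P) = (\<integral>\<^sup>+z. ?g z \<partial>distr ?P ?P (\<lambda>z. \<lambda>j\<in>J. r + z j))"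
        by (simp only: distr_PiM_lborel_translate[OF finite])
      also have "\<dots> = (\<integral>\<^sup>+z. ?g (\<lambda>j\<in>J. r + z j) \<partial>?P)"
        by (rule nn_integral_distr) simp_all
      also have "\<dots> = (\<integral>\<^sup>+z. f (\<lambda>j. ereal r + face_emb J z j) * w r * K (face_emb J z) \<partial>?P)"
      proof (rule nn_integral_cong)
        fix z
        have "(\<lambda>j. ereal (- r) + face_emb J (\<lambda>j\<in>J. r + z j) j) = face_emb J z"
          by (auto simp: face_emb_def)
        then show "?g (\<lambda>j\<in>J. r + z j) = f (\<lambda>j. ereal r + face_emb J z j) * w r * K (face_emb J z)"
          by (simp only: tr)
      qed
      finally show "(\<integral>\<^sup>+z. f (\<lambda>j. ereal r + face_emb J z j) * w r * K (face_emb J z) \<partial>?P) = (\<integral>\<^sup>+z. ?g z \<partial>?P)"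
        by simp
    qed
    also have "\<dots> = (\<integral>\<^sup>+z. (\<integral>\<^sup>+r. f (face_emb J z) * w r * K (\<lambda>j. ereal (- r) + face_emb J z j) \<partial>lborel) \<partial>?P)"
      by (rule Fubini'[symmetric]) simp
    also have "\<dots> = ?r"
      unfolding mult.assoc by (intro nn_integral_cong nn_integral_cmult) simp
    finally show ?thesis .
  qed
  have sw: "(\<lambda>(y, r). (- r, y)) \<in> measurable (ext_borel \<Otimes>\<^sub>M lborel) (lborel \<Otimes>\<^sub>M ext_borel)"
    by (simp add: split_beta)
  have Km: "(\<lambda>(y, r). w r * K (\<lambda>j. ereal (- r) + y j)) \<in> borel_measurable (ext_borel \<Otimes>\<^sub>M lborel)"
    using measurable_compose[OF sw measurable_compose[OF measurable_ext_translate K]]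
    by (simp add: split_beta)
  have "(\<lambda>y. (\<integral>\<^sup>+r. f (\<lambda>j. ereal r + y j) * w r \<partial>lborel) * K y) \<in> borel_measurable ext_borel"
    by (intro borel_measurable_times_ennreal borel_measurable_translate_integral f K w)
  then have m1: "(\<lambda>y. (\<integral>\<^sup>+r. f (\<lambda>j. ereal r + y j) * w r \<partial>lborel) * K y) \<in> borel_measurable upsilon"
    by (simp cong: measurable_cong_sets)
  have "(\<lambda>u. f u * (\<integral>\<^sup>+r. w r * K (\<lambda>j. ereal (- r) + u j) \<partial>lborel)) \<in> borel_measurable ext_borel"
    by (intro borel_measurable_times_ennreal lborel.borel_measurable_nn_integral Km f)
  then have m2: "(\<lambda>u. f u * (\<integral>\<^sup>+r. w r * K (\<lambda>j. ereal (- r) + u j) \<partial>lborel)) \<in> borel_measurable upsilon"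
    by (simp cong: measurable_cong_sets)
  show ?thesis
    unfolding nn_integral_upsilon[OF m1] nn_integral_upsilon[OF m2] face ..
qed

section \<open>Maxima along the diagonal\<close>

lemma ext_exp_nonneg [simp]: "0 \<le> ext_exp x"
  by (simp add: ext_exp_def)

lemma ext_exp_measurable [measurable]: "ext_exp \<in> borel_measurable borel"
  unfolding ext_exp_def[abs_def] by measurable

lemma ext_exp_mono:
  assumes "x \<le> y" "y < \<infinity>"
  shows "ext_exp x \<le> ext_exp y"
  using assms by (cases x; cases y) (auto simp: ext_exp_def)

lemma exp_times_ext_exp_le_iff:
  assumes "y < \<infinity>"
  shows "exp (- x) * ext_exp y \<le> exp r \<longleftrightarrow> ereal (- r) + y \<le> ereal x"
proof (cases y)
  case (real t)
  then have "exp (- x) * ext_exp y = exp (t - x)"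
    by (simp add: ext_exp_def exp_diff exp_minus field_simps)
  with real show ?thesis by auto
qed (use assms in \<open>auto simp: ext_exp_def\<close>)

text \<open>This is exp (max (u - x)), written in the form of the generator identity at the point
  exp (-x), which also covers coordinates equal to -\<infinity>.\<close>

definition scaled_max :: "('d::finite \<Rightarrow> real) \<Rightarrow> ('d \<Rightarrow> ereal) \<Rightarrow> real" where
  "scaled_max x u = Max (range (\<lambda>j. exp (- x j) * ext_exp (u j)))"

lemma scaled_max_measurable [measurable]: "scaled_max x \<in> borel_measurable ext_borel"
  unfolding scaled_max_def[abs_def] by (intro borel_measurable_Max) auto

lemma scaled_max_ge: "exp (- x j) * ext_exp (u j) \<le> scaled_max x u"
  by (simp add: scaled_max_def)

lemma scaled_max_leI:
  "(\<And>j. exp (- x j) * ext_exp (u j) \<le> c) \<Longrightarrow> scaled_max x u \<le> c"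
  by (simp add: scaled_max_def)

lemma scaled_max_nonneg [simp]: "0 \<le> scaled_max x u"
  by (rule order_trans[OF _ scaled_max_ge]) simp

lemma scaled_max_le_exp_iff:
  assumes "u \<in> space ext_borel"
  shows "scaled_max x u \<le> exp r \<longleftrightarrow> (\<lambda>j. ereal (- r) + u j) \<in> ext_atMost x"
proof -
  have "scaled_max x u \<le> exp r \<longleftrightarrow> (\<forall>j. exp (- x j) * ext_exp (u j) \<le> exp r)"
    by (simp add: scaled_max_def)
  also have "\<dots> \<longleftrightarrow> (\<lambda>j. ereal (- r) + u j) \<in> ext_atMost x"
    using assms exp_times_ext_exp_le_iff[of "u _"]
    by (simp only: ext_atMost_def space_ext_borel mem_Collect_eq)
  finally show ?thesis .
qed

text \<open>The negation of the preceding criterion at the corner 0.\<close>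

lemma exp_less_scaled_max_0_iff:
  assumes "u \<in> space ext_borel"
  shows "exp r < scaled_max (\<lambda>_. 0) u \<longleftrightarrow> 0 < Max (range (\<lambda>j. ereal (- r) + u j))"
proof -
  have "(\<lambda>j. ereal (- r) + u j) \<in> ext_atMost (\<lambda>_. 0) \<longleftrightarrow> Max (range (\<lambda>j. ereal (- r) + u j)) \<le> 0"
    by (simp add: ext_atMost_def zero_ereal_def)
  then show ?thesis
    using scaled_max_le_exp_iff[OF assms, of "\<lambda>_. 0" r] by (simp only: not_le[symmetric])
qed

text \<open>Since exp (-min a 0) = max (exp (-a)) 1, the two maxima can be taken in either order.
  The positive part of exp (max u) - exp (max (u - x)) thereby becomes a plain difference of two
  scaled maxima.\<close>

lemma scaled_max_min_0:
  "scaled_max (\<lambda>j. min (x j) 0) u = max (scaled_max x u) (scaled_max (\<lambda>_. 0) u)"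
proof (rule antisym)
  have pointwise: "exp (- min (x j) 0) * ext_exp (u j) = max (exp (- x j) * ext_exp (u j)) (exp (- 0) * ext_exp (u j))" for j
  proof -
    have "exp (- min (x j) 0) = max (exp (- x j)) (exp (- 0))" by (auto simp: min_def max_def)
    then show ?thesis by (simp only: max_mult_distrib_right ext_exp_nonneg if_True)
  qed
  show "scaled_max (\<lambda>j. min (x j) 0) u \<le> max (scaled_max x u) (scaled_max (\<lambda>_. 0) u)"
  proof (rule scaled_max_leI)
    fix j
    show "exp (- min (x j) 0) * ext_exp (u j) \<le> max (scaled_max x u) (scaled_max (\<lambda>_. 0) u)"
      unfolding pointwise by (rule max.mono[OF scaled_max_ge scaled_max_ge[of "\<lambda>_. 0"]])
  qed
  show "max (scaled_max x u) (scaled_max (\<lambda>_. 0) u) \<le> scaled_max (\<lambda>j. min (x j) 0) u"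
  proof (rule max.boundedI; rule scaled_max_leI)
    fix j
    show "exp (- x j) * ext_exp (u j) \<le> scaled_max (\<lambda>j. min (x j) 0) u"
      "exp (- 0) * ext_exp (u j) \<le> scaled_max (\<lambda>j. min (x j) 0) u"
      using scaled_max_ge[of "\<lambda>j. min (x j) 0" j u] unfolding pointwise by auto
  qed
qed

lemma scaled_max_0:
  assumes "u \<in> space ext_borel"
  shows "scaled_max (\<lambda>_. 0) u = ext_exp (Max (range u))"
proof (rule antisym)
  have "Max (range u) \<in> range u" by (rule Max_in) auto
  then obtain k where k: "Max (range u) = u k" by (rule imageE)
  show "ext_exp (Max (range u)) \<le> scaled_max (\<lambda>_. 0) u"
    using scaled_max_ge[of "\<lambda>_. 0" k u] k by simp
  show "scaled_max (\<lambda>_. 0) u \<le> ext_exp (Max (range u))"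
  proof (rule scaled_max_leI)
    fix j
    have "u j \<le> Max (range u)" by simp
    moreover have "Max (range u) < \<infinity>" using assms k by (simp add: space_ext_borel)
    ultimately show "exp (- 0) * ext_exp (u j) \<le> ext_exp (Max (range u))"
      by (simp add: ext_exp_mono)
  qed
qed

text \<open>The weights exp (-x) are positive, so a scaled maximum vanishes only if every coordinate
  of \<open>u\<close> is -\<infinity>, whatever the corner.\<close>

lemma scaled_max_eq_0:
  assumes "scaled_max x u = 0"
  shows "scaled_max x' u = 0"
proof -
  have "ext_exp (u j) = 0" for j
  proof -
    have "exp (- x j) * ext_exp (u j) \<le> 0" using scaled_max_ge[of x j u] assms by simp
    then show ?thesis using ext_exp_nonneg[of "u j"] by (simp add: mult_le_0_iff)
  qed
  then show ?thesis by (simp add: scaled_max_def)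
qed

text \<open>The second assumption makes \<open>a\<close> positive whenever the set of r is nonempty,
  so this set is the bounded interval from ln a to ln b and exp is its own antiderivative.\<close>

lemma nn_integral_exp_Ico:
  fixes a b :: real
  assumes "0 \<le> a" and "a = 0 \<Longrightarrow> b = 0"
  shows "(\<integral>\<^sup>+r. ennreal (exp r) * indicator {r. a \<le> exp r \<and> exp r < b} r \<partial>lborel) = ennreal (max a b - a)"
proof (cases "a < b")
  case True
  then have pos: "0 < a" "0 < b" using assms by (cases "a = 0"; force)+
  have "a \<le> exp r \<longleftrightarrow> ln a \<le> r" "exp r < b \<longleftrightarrow> r < ln b" for r
    using exp_le_cancel_iff[of "ln a" r] exp_less_cancel_iff[of r "ln b"] pos by (simp_all only: exp_ln)
  then have "{r. a \<le> exp r \<and> exp r < b} = {ln a ..< ln b}" by auto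
  \<comment> \<open>Closing the interval at ln b adds a null set.\<close>
  then have "(\<integral>\<^sup>+r. ennreal (exp r) * indicator {r. a \<le> exp r \<and> exp r < b} r \<partial>lborel)
      = (\<integral>\<^sup>+r. ennreal (exp r) * indicator {ln a .. ln b} r \<partial>lborel)"
    using AE_lborel_singleton[of "ln b"]
    by (intro nn_integral_cong_AE) (auto elim!: eventually_mono simp: indicator_def)
  also have "\<dots> = exp (ln b) - exp (ln a)"
    by (rule nn_integral_FTC_Icc) (use True pos in \<open>auto intro!: derivative_eq_intros\<close>)
  finally show ?thesis using pos True by simp
next
  case False
  then have "{r. a \<le> exp r \<and> exp r < b} = {}" by auto
  with False show ?thesis by simp
qed

text \<open>The inner integral left by the change of variables: the points u - r of the ray lie in
  the orthant and exceed 0 exactly for max (u - x) \<le> r < max u.\<close>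

lemma nn_integral_exp_ray:
  assumes u: "u \<in> space ext_borel"
  shows "(\<integral>\<^sup>+r. ennreal (exp r) * indicator (ext_atMost x \<inter> {y. 0 < Max (range y)}) (\<lambda>j. ereal (- r) + u j) \<partial>lborel)
       = ennreal (scaled_max (\<lambda>j. min (x j) 0) u - scaled_max x u)"
proof -
  have "indicator (ext_atMost x \<inter> {y. 0 < Max (range y)}) (\<lambda>j. ereal (- r) + u j)
      = (indicator {r. scaled_max x u \<le> exp r \<and> exp r < scaled_max (\<lambda>_. 0) u} r :: ennreal)" for r
    using scaled_max_le_exp_iff[OF u, of x r] exp_less_scaled_max_0_iff[OF u, of r]
    by (simp add: indicator_def)
  then show ?thesis
    unfolding scaled_max_min_0
    using nn_integral_exp_Ico[of "scaled_max x u" "scaled_max (\<lambda>_. 0) u"] scaled_max_eq_0[of x u "\<lambda>_. 0"]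
    by simp
qed

section \<open>The generator and the law of the Pareto vector\<close>

context
  fixes N :: "'b measure" and U :: "'b \<Rightarrow> 'd::finite \<Rightarrow> ereal" and G :: "('d \<Rightarrow> real) measure"
  assumes gen: "U_generator N U G"
begin

lemma U_measurable [measurable]: "U \<in> measurable N ext_borel"
  using gen by (simp add: U_generator_def)

text \<open>A non-integrable function would have Bochner integral 0, but the generator prescribes
  1.\<close>

lemma integrable_ext_exp: "integrable N (\<lambda>\<omega>. ext_exp (U \<omega> j))"
  using gen not_integrable_integral_eq[of N "\<lambda>\<omega>. ext_exp (U \<omega> j)"]
  by (auto simp: U_generator_def)

lemma integrable_scaled_max: "integrable N (\<lambda>\<omega>. scaled_max x (U \<omega>))"
proof (rule Bochner_Integration.integrable_bound)
  show "integrable N (\<lambda>\<omega>. \<Sum>j\<in>UNIV. exp (- x j) * ext_exp (U \<omega> j))"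
    by (intro Bochner_Integration.integrable_sum integrable_mult_right integrable_ext_exp)
  have "scaled_max x u \<le> (\<Sum>j\<in>UNIV. exp (- x j) * ext_exp (u j))" for u
    by (rule scaled_max_leI) (rule member_le_sum, auto)
  then show "AE \<omega> in N. norm (scaled_max x (U \<omega>)) \<le> norm (\<Sum>j\<in>UNIV. exp (- x j) * ext_exp (U \<omega> j))"
    by (intro AE_I2) (simp add: sum_nonneg)
qed simp

text \<open>A single coordinate already contributes exp (-x j), its weight times a mean of
  1.\<close>

lemma integral_scaled_max_pos: "0 < (\<integral>\<omega>. scaled_max x (U \<omega>) \<partial>N)"
proof -
  fix j :: 'd
  have "0 < (\<integral>\<omega>. exp (- x j) * ext_exp (U \<omega> j) \<partial>N)"
    using gen by (simp add: U_generator_def)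
  also have "\<dots> \<le> (\<integral>\<omega>. scaled_max x (U \<omega>) \<partial>N)"
    by (intro integral_mono integrable_mult_right integrable_ext_exp integrable_scaled_max scaled_max_ge)
  finally show ?thesis .
qed

lemma integral_scaled_max_0:
  "(\<integral>\<omega>. scaled_max (\<lambda>_. 0) (U \<omega>) \<partial>N) = (\<integral>\<omega>. ext_exp (Max (range (U \<omega>))) \<partial>N)"
  by (intro Bochner_Integration.integral_cong refl scaled_max_0 measurable_space[OF U_measurable])

lemma nn_integral_scaled_max_diff:
  "(\<integral>\<^sup>+\<omega>. ennreal (scaled_max (\<lambda>j. min (x j) 0) (U \<omega>) - scaled_max x (U \<omega>)) \<partial>N)
   = ennreal ((\<integral>\<omega>. scaled_max (\<lambda>j. min (x j) 0) (U \<omega>) \<partial>N) - (\<integral>\<omega>. scaled_max x (U \<omega>) \<partial>N))"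
  by (subst nn_integral_eq_integral)
    (auto simp: integrable_scaled_max scaled_max_min_0)

lemma exponent_measure_box_complement:
  assumes "exponent_measure G \<mu>"
  shows "emeasure \<mu> (punctured_orthant - {z. \<forall>j. 0 \<le> z j \<and> z j \<le> exp (x j)})
       = ennreal (\<integral>\<omega>. scaled_max x (U \<omega>) \<partial>N)" (is "?m = ennreal ?L")
proof -
  have inv: "1 / ereal (exp (- x j)) = ereal (exp (x j))" for j
    by (simp add: exp_minus inverse_eq_divide[symmetric] one_ereal_def)
  \<comment> \<open>The generator identity at exp (-x) involves the Frechet version at the
    reciprocal, which is the corner exp x of the box.\<close>
  have L: "?L = - ln (ext_exp (- enn2ereal ?m))"
  proof -
    have "?L = stdf G (\<lambda>j. exp (- x j))"
      using gen by (simp add: U_generator_def scaled_max_def)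
    also have "\<dots> = - ln (frechet_version G (\<lambda>j. ereal (exp (x j))))"
      by (simp only: stdf_def inv)
    also have "frechet_version G (\<lambda>j. ereal (exp (x j))) = ext_exp (- enn2ereal ?m)"
      using assms by (simp add: exponent_measure_def)
    finally show ?thesis .
  qed
  show ?thesis
  proof (cases ?m)
    case (real t)
    then show ?thesis using L by (simp add: ext_exp_def)
  next
    case top
    \<comment> \<open>Infinite mass is excluded by the convention ln 0 = 0: it would force
      \<open>?L\<close> to be 0, against positivity.\<close>
    then show ?thesis using L integral_scaled_max_pos[of x] by (simp add: ext_exp_def)
  qed
qed

lemma mgp_law_ext_atMost:
  assumes "mgp_law G H"
  shows "emeasure H (ext_atMost x)
       = ennreal (1 / (\<integral>\<omega>. scaled_max (\<lambda>_. 0) (U \<omega>) \<partial>N))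
         * ennreal ((\<integral>\<omega>. scaled_max (\<lambda>j. min (x j) 0) (U \<omega>) \<partial>N) - (\<integral>\<omega>. scaled_max x (U \<omega>) \<partial>N))"
proof -
  obtain \<mu> where \<mu>: "exponent_measure G \<mu>"
    and H: "sets H = sets ext_borel" "\<And>B. B \<in> sets borel \<Longrightarrow> B \<subseteq> {x. \<forall>j. 0 \<le> x j} \<Longrightarrow>
      emeasure H {y\<in>space H. (\<lambda>j. ext_exp (y j)) \<in> B} = emeasure \<mu> (B \<inter> exceedance_set) / emeasure \<mu> exceedance_set"
    using assms by (auto simp: mgp_law_def)
  define box where "box x = {z. \<forall>j. 0 \<le> z j \<and> z j \<le> exp (x j)}" for x :: "'d \<Rightarrow> real"
  define L where "L x = (\<integral>\<omega>. scaled_max x (U \<omega>) \<partial>N)" for x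
  have box [measurable]: "box x \<in> sets borel" for x
  proof -
    have "box x = {z \<in> space borel. \<forall>j. 0 \<le> z j \<and> z j \<le> exp (x j)}" by (simp add: box_def)
    then show ?thesis by simp
  qed
  have sub: "box x \<subseteq> {x. \<forall>j. 0 \<le> x j}"
    by (auto simp: box_def)
  have m: "emeasure \<mu> (punctured_orthant - box x) = ennreal (L x)" for x
    using exponent_measure_box_complement[OF \<mu>] by (simp add: box_def L_def)
  have sets: "punctured_orthant - box x \<in> sets \<mu>" for x
  proof -
    have "punctured_orthant - box x = punctured_orthant \<inter> - box x" by auto
    then show ?thesis
      using \<mu> borel_comp[OF box[of x]] by (auto simp: exponent_measure_def sets_restrict_space)
  qed
  have exp_min: "exp (min a 0) = min (exp a) (1 :: real)" for a :: real
    by (simp add: min_def)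
  have exc: "exceedance_set = punctured_orthant - box (\<lambda>_. 0)"
  proof (intro set_eqI iffI)
    fix z :: "'d \<Rightarrow> real" assume "z \<in> exceedance_set"
    then obtain j where j: "\<forall>j. 0 \<le> z j" "1 < z j" by (auto simp: exceedance_set_def)
    then have "z j \<noteq> 0" "\<not> z j \<le> exp 0" by auto
    \<comment> \<open>The exceedances are the complement of the unit box, whose corner is exp
      0.\<close>
    with j show "z \<in> punctured_orthant - box (\<lambda>_. 0)"
      unfolding punctured_orthant_def box_def by blast
  qed (auto simp: exceedance_set_def punctured_orthant_def box_def not_le dest: leD)
  \<comment> \<open>The exceedances inside the box are what the complement of the smaller box, with
    corner min (exp x) 1, has in excess of the complement of the box. Both have finite mass by
    \<open>m\<close>, so their measures may be subtracted.\<close>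
  have "box x \<inter> exceedance_set = (punctured_orthant - box (\<lambda>j. min (x j) 0)) - (punctured_orthant - box x)"
  proof -
    have "box (\<lambda>j. min (x j) 0) = box x \<inter> box (\<lambda>_. 0)"
      by (auto simp: box_def exp_min)
    then show ?thesis by (auto simp: exc)
  qed
  also have "emeasure \<mu> \<dots> = ennreal (L (\<lambda>j. min (x j) 0)) - ennreal (L x)"
    unfolding m[symmetric] by (rule emeasure_Diff) (auto simp: m sets, auto simp: box_def exp_min)
  also have "\<dots> = ennreal (L (\<lambda>j. min (x j) 0) - L x)"
    using integral_scaled_max_pos by (simp add: ennreal_minus L_def less_imp_le)
  finally have num: "emeasure \<mu> (box x \<inter> exceedance_set) = ennreal (L (\<lambda>j. min (x j) 0) - L x)" .
  \<comment> \<open>The componentwise exponential, with -\<infinity> going to 0, pulls the box at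
    exp x back to the orthant at x.\<close>
  have "y \<in> space H \<and> (\<lambda>j. ext_exp (y j)) \<in> box x \<longleftrightarrow> y \<in> ext_atMost x" for y
  proof -
    have "ext_exp (y j) \<le> exp (x j) \<longleftrightarrow> y j \<le> ereal (x j)" if "y \<in> space ext_borel" for j
      using that exp_times_ext_exp_le_iff[of "y j" 0 "x j"]
      by (cases "y j") (auto simp: space_ext_borel ext_exp_def dest: spec[of _ j])
    then show ?thesis
      using sets_eq_imp_space_eq[OF H(1)] ext_atMost_subset[of x] by (auto simp: box_def ext_atMost_def)
  qed
  then have "ext_atMost x = {y\<in>space H. (\<lambda>j. ext_exp (y j)) \<in> box x}" by auto
  then have "emeasure H (ext_atMost x) = ennreal (L (\<lambda>j. min (x j) 0) - L x) / ennreal (L (\<lambda>_. 0))"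
    using H(2)[OF box sub] num m[of "\<lambda>_. 0"] by (simp only: exc)
  also have "\<dots> = ennreal (1 / L (\<lambda>_. 0)) * ennreal (L (\<lambda>j. min (x j) 0) - L x)"
    using integral_scaled_max_pos[of "\<lambda>_. 0"]
    by (simp add: divide_ennreal_def inverse_ennreal L_def inverse_eq_divide mult.commute)
  finally show ?thesis by (simp add: L_def)
qed

end

theorem theorem3p9:
  fixes G :: "('d::finite \<Rightarrow> real) measure"
    and H :: "('d \<Rightarrow> ereal) measure"
    and M :: "'a measure" and Y :: "'a \<Rightarrow> 'd \<Rightarrow> ereal"
    and N :: "'b measure" and U :: "'b \<Rightarrow> 'd \<Rightarrow> ereal"
    and f\<^sub>U :: "('d \<Rightarrow> ereal) \<Rightarrow> ennreal"
  assumes "multivariate_extreme_value G"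
    and "gumbel_margins G"
    and "mgp_law G H"
    and "prob_space M"
    and "Y \<in> measurable M ext_borel"
    and "distr M ext_borel Y = H"
    and "U_generator N U G"
    and "distributed N upsilon U f\<^sub>U"
  shows "distributed M upsilon Y
    (\<lambda>y. indicator {y. Max (range y) > 0} y
         * ennreal (1 / (\<integral>\<omega>. ext_exp (Max (range (U \<omega>))) \<partial>N))
         * (\<integral>\<^sup>+ r. f\<^sub>U (\<lambda>j. ereal r + y j) * ennreal (exp r) \<partial>lborel))"
    (is "distributed M upsilon Y ?h")
proof -
  let ?c = "\<integral>\<omega>. scaled_max (\<lambda>_. 0) (U \<omega>) \<partial>N"
  let ?I = "\<lambda>y. \<integral>\<^sup>+ r. f\<^sub>U (\<lambda>j. ereal r + y j) * ennreal (exp r) \<partial>lborel"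
  let ?pos = "{y :: 'd \<Rightarrow> ereal. Max (range y) > 0}"
  note gen = assms(7)
  have f [measurable]: "f\<^sub>U \<in> borel_measurable ext_borel"
    using distributed_borel_measurable[OF assms(8)] by (simp cong: measurable_cong_sets)
  have [measurable]: "?I \<in> borel_measurable ext_borel"
    by (rule borel_measurable_translate_integral) simp_all
  have "(\<lambda>y. Max (range (\<lambda>j. y j))) \<in> borel_measurable (ext_borel :: ('d \<Rightarrow> ereal) measure)"
    by (rule borel_measurable_Max) simp_all
  then have pos [measurable]: "Measurable.pred ext_borel (\<lambda>y :: 'd \<Rightarrow> ereal. y \<in> ?pos)"
    by simp
  \<comment> \<open>The constant of the statement exponentiates the maximum, whereas
    \<open>?c\<close> takes the maximum of exponentials; monotonicity of exp identifies
    them.\<close>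
  have h_eq: "?h y = ennreal (1 / ?c) * (?I y * indicator ?pos y)" for y
    by (simp add: integral_scaled_max_0[OF gen] mult_ac)
  have "?h \<in> borel_measurable ext_borel"
    unfolding h_eq by measurable
  then have h: "?h \<in> borel_measurable upsilon"
    by (simp cong: measurable_cong_sets)
  have "H = density upsilon ?h"
  proof (rule ext_borel_measure_eqI)
    show "finite_measure H"
      using assms(3) by (simp add: mgp_law_def prob_space.finite_measure)
    show "sets H = sets ext_borel" using assms(3) by (simp add: mgp_law_def)
    show "sets (density upsilon ?h) = sets ext_borel" by simp
    fix x :: "'d \<Rightarrow> real"
    let ?D = "\<lambda>u. ennreal (scaled_max (\<lambda>j. min (x j) 0) u - scaled_max x u)"
    \<comment> \<open>The orthant under test and the constraint max y > 0 from the density merge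
      into one test function.\<close>
    let ?K = "indicator (ext_atMost x \<inter> ?pos) :: _ \<Rightarrow> ennreal"
    have K: "?K \<in> borel_measurable ext_borel" by simp
    have "emeasure (density upsilon ?h) (ext_atMost x) = (\<integral>\<^sup>+y. ?h y * indicator (ext_atMost x) y \<partial>upsilon)"
      by (rule emeasure_density[OF h]) simp
    also have "\<dots> = (\<integral>\<^sup>+y. ennreal (1 / ?c) * (?I y * ?K y) \<partial>upsilon)"
      unfolding h_eq by (intro nn_integral_cong) (auto simp: indicator_def)
    also have "\<dots> = ennreal (1 / ?c) * (\<integral>\<^sup>+y. ?I y * ?K y \<partial>upsilon)"
      using K by (intro nn_integral_cmult) (simp cong: measurable_cong_sets)
    also have "(\<integral>\<^sup>+y. ?I y * ?K y \<partial>upsilon)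
        = (\<integral>\<^sup>+u. f\<^sub>U u * (\<integral>\<^sup>+r. ennreal (exp r) * ?K (\<lambda>j. ereal (- r) + u j) \<partial>lborel) \<partial>upsilon)"
      by (rule nn_integral_upsilon_translate[OF f K]) simp
    also have "\<dots> = (\<integral>\<^sup>+u. f\<^sub>U u * ?D u \<partial>upsilon)"
      by (intro nn_integral_cong arg_cong2[where f = "(*)"] refl nn_integral_exp_ray) simp
    \<comment> \<open>Integration against the density of \<open>U\<close> becomes an expectation,
      which the generator identity has linked to the exponent measure.\<close>
    also have "\<dots> = (\<integral>\<^sup>+\<omega>. ?D (U \<omega>) \<partial>N)"
      by (rule distributed_nn_integral[OF assms(8)]) (simp cong: measurable_cong_sets)
    also have "ennreal (1 / ?c) * \<dots> = emeasure H (ext_atMost x)"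
      unfolding mgp_law_ext_atMost[OF gen assms(3)] nn_integral_scaled_max_diff[OF gen] ..
    finally show "emeasure H (ext_atMost x) = emeasure (density upsilon ?h) (ext_atMost x)" ..
  qed
  moreover have "distr M upsilon Y = H"
    unfolding assms(6)[symmetric] by (rule distr_cong) simp_all
  ultimately show ?thesis
    using h assms(5) by (simp add: distributed_def cong: measurable_cong_sets)
qed

end
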